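(* Let $\mathbb{F}$ be a field and let $f \in \mathbb{F}[x_1, \ldots, x_n]$ be a homogeneous polynomial of degree $d$. Suppose $\mathrm{dc}(f) = s$. Then $\mathrm{habp}(f) \le O(d^5 \cdot s)$; that is, there is an absolute constant $c$ such that $f$ is computed by a homogeneous algebraic branching program of size at most $c\, d^5 s$.
   Context: Here "linear function" in $x_1,\dots,x_n$ means an affine function $\alpha_0+\sum_i \alpha_i x_i$; it is homogeneous linear if $\alpha_0=0$. A determinantal representation of $f$ of size $s$ is an $s\times s$ matrix $M$ whose entries are linear functions in $x_1,\ldots,x_n$ with $\mathrm{Det}(M)=f$; $\mathrm{dc}(f)$ is the minimal such $s$. An algebraic branching program (ABP) of width $w$ and size $s$ for $f$ is an expression $f=\mathbf{b}^T M_1 M_2\cdots M_k \mathbf{c}$ where $\mathbf{b}\in\mathbb{F}[\mathbf{x}]^{w_0}$, $\mathbf{c}\in\mathbb{F}[\mathbf{x}]^{w_k}$, $M_i\in \mathbb{F}[\mathbf{x}]^{w_{i-1}\times w_i}$ all have linear functions as entries, $w_i\le w$ for all $0\le i\le k$, and $\sum_{i=0}^k w_i\le s$. The ABP is homogeneous if all entries of $\mathbf{b},\mathbf{c},M_i$ are homogeneous linear functions. $\mathrm{habp}(f)$ denotes the minimal size of a homogeneous ABP computing $f$.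
   Formalization: The formal statement assumes d ≥ 2: a homogeneous ABP as defined has at least the two homogeneous linear factors b and c, so nonzero forms of degree 0 or 1 (such as f = x_1 with dc(f) = 1) have no homogeneous ABP at all; the constant is fixed as 100. *)

theory Defs
  imports
    "HOL-Library.Poly_Mapping"
    "HOL-Library.Extended_Nat"
    "Jordan_Normal_Form.Determinant"
begin

text \<open>
  A polynomial is a finitely supported function from monomials to coefficients, a monomial
  being a finitely supported function from variable indices to exponents. The variables
  \<open>x\<^sub>1, \<dots>, x\<^sub>n\<close> have the indices \<open>0, \<dots>, n - 1\<close>.
\<close>

type_synonym 'a mpoly = "(nat \<Rightarrow>\<^sub>0 nat) \<Rightarrow>\<^sub>0 'a"

definition Const :: "'a::zero \<Rightarrow> 'a mpoly"
  where "Const a = Poly_Mapping.single 0 a"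

definition Var :: "nat \<Rightarrow> 'a::zero_neq_one mpoly"
  where "Var i = Poly_Mapping.single (Poly_Mapping.single i 1) 1"

definition polys_in :: "nat \<Rightarrow> 'a::zero mpoly set"
  where "polys_in n = {f. \<forall>m \<in> Poly_Mapping.keys f. Poly_Mapping.keys m \<subseteq> {..<n}}"

definition monom_degree :: "(nat \<Rightarrow>\<^sub>0 nat) \<Rightarrow> nat"
  where "monom_degree m = (\<Sum>i \<in> Poly_Mapping.keys m. Poly_Mapping.lookup m i)"

text \<open>The zero polynomial is homogeneous of every degree.\<close>

definition homogeneous :: "nat \<Rightarrow> 'a::zero mpoly \<Rightarrow> bool"
  where "homogeneous d f \<longleftrightarrow> (\<forall>m \<in> Poly_Mapping.keys f. monom_degree m = d)"

definition linear_functions :: "nat \<Rightarrow> 'a::field mpoly set"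
  where "linear_functions n =
    {Const (a0 :: 'a) + (\<Sum>i<n. Const (a i) * Var i) | a0 a. True}"

definition hom_linear_functions :: "nat \<Rightarrow> 'a::field mpoly set"
  where "hom_linear_functions n = {\<Sum>i<n. Const (a i :: 'a) * Var i | a. True}"

definition det_repr :: "nat \<Rightarrow> nat \<Rightarrow> 'a::field mpoly mat \<Rightarrow> 'a mpoly \<Rightarrow> bool"
  where "det_repr n s M f \<longleftrightarrow>
    M \<in> carrier_mat s s \<and> elements_mat M \<subseteq> linear_functions n \<and> det M = f"

text \<open>
  Minima are taken in the extended naturals, where the infimum of a nonempty set is its least
  element and the infimum of the empty set is \<open>\<infinity>\<close>.
\<close>

definition dc :: "nat \<Rightarrow> 'a::field mpoly \<Rightarrow> enat"
  where "dc n f = Inf {enat s | s. \<exists>M. det_repr n s M f}"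

text \<open>
  The matrix \<open>M i\<close> is used for \<open>1 \<le> i \<le> k\<close> only. The product \<open>b\<^sup>T M\<^sub>1 \<cdots> M\<^sub>k c\<close> is bracketed
  to the right.
\<close>

definition abp_product ::
    "nat \<Rightarrow> 'r::comm_ring_1 vec \<Rightarrow> (nat \<Rightarrow> 'r mat) \<Rightarrow> 'r vec \<Rightarrow> 'r"
  where "abp_product k b M c = b \<bullet> foldr (\<lambda>i v. M i *\<^sub>v v) [1..<Suc k] c"

text \<open>
  An ABP of width \<open>w\<close> and size \<open>s\<close> for \<open>f\<close> with entries from \<open>L\<close>, where \<open>W i\<close> is the width of
  layer \<open>i\<close>; \<open>L\<close> is the set of linear functions for general ABPs and the set of homogeneous
  linear functions for homogeneous ones.
\<close>

definition has_abp :: "'r::comm_ring_1 set \<Rightarrow> nat \<Rightarrow> nat \<Rightarrow> 'r \<Rightarrow> bool"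
  where "has_abp L w s f \<longleftrightarrow>
    (\<exists>k (W :: nat \<Rightarrow> nat) b M c.
       b \<in> carrier_vec (W 0) \<and> set\<^sub>v b \<subseteq> L \<and>
       c \<in> carrier_vec (W k) \<and> set\<^sub>v c \<subseteq> L \<and>
       (\<forall>i \<in> {1..k}. M i \<in> carrier_mat (W (i - 1)) (W i) \<and> elements_mat (M i) \<subseteq> L) \<and>
       (\<forall>i \<le> k. W i \<le> w) \<and>
       (\<Sum>i\<le>k. W i) \<le> s \<and>
       f = abp_product k b M c)"

text \<open>
  A homogeneous ABP with \<open>k\<close> matrices is a product of \<open>k + 2\<close> homogeneous linear factors, so it
  computes a form of degree \<open>k + 2 \<ge> 2\<close>; hence \<open>habp\<close> is \<open>\<infinity>\<close> on nonzero forms of degree 0 or 1.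
\<close>

definition habp :: "nat \<Rightarrow> 'a::field mpoly \<Rightarrow> enat"
  where "habp n f = Inf {enat s | s. \<exists>w. has_abp (hom_linear_functions n) w s f}"

text \<open>
  An absolute constant must not depend on the field. A HOL formula cannot quantify over the type
  of the field, and an existentially quantified constant inside a theorem about a field type
  could depend on that type. Hence the constant is a fixed number; its particular value,
  chosen generously, has no significance.
\<close>

definition absolute_constant :: nat
  where "absolute_constant = 100"

end

theory Submission
  imports Defs "HOL-Computational_Algebra.Polynomial_FPS"
begin

text \<open>
  Multiplying \<open>M\<close> by invertible scalar matrices turns its constant part into
  \<open>J = diag(1, \<dots>, 1, 0, \<dots>, 0)\<close> with \<open>r\<close> ones, so up to a scalar \<open>f = det (J - N)\<close> with
  homogeneous linear \<open>N\<close>, and \<open>det (J - u N) = u\<^sup>d f\<close> for a formal variable \<open>u\<close>. The last \<open>e = s - r\<close>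
  rows are divisible by \<open>u\<close>, hence \<open>e \<le> d\<close> unless \<open>f = 0\<close>.

  Let \<open>N\<^sub>z\<close> be \<open>N\<close> with its last \<open>e\<close> rows multiplied by a second variable \<open>z\<close>. The coefficient of
  \<open>z\<^sup>e\<close> in \<open>det (1 - u N\<^sub>z)\<close> is \<open>det (J - u N)\<close>. Bordering one row and column at a time gives
  \<open>det (1 - u N\<^sub>z) = det (1 - u A) g\<^sub>r \<cdots> g\<^bsub>s-1\<^esub>\<close>, where \<open>A\<close> is the leading \<open>r \<times> r\<close> block of \<open>N\<close> and
  \<open>1 - g\<^sub>h\<close> enumerates the closed walks that return to their maximal vertex \<open>h\<close> exactly once. As
  \<open>det (1 - u A)\<close> is free of \<open>z\<close> and has constant term 1, and \<open>u\<^sup>d f\<close> has no lower terms in \<open>u\<close>, the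
  coefficient of \<open>u\<^sup>d z\<^sup>e\<close> in \<open>g\<^sub>r \<cdots> g\<^bsub>s-1\<^esub>\<close> is \<open>f\<close>. A homogeneous ABP whose layers count the power
  of \<open>u\<close> and whose nodes record the current head \<open>h\<close>, the current vertex and the remaining power of
  \<open>z\<close> computes this coefficient with at most \<open>e\<^sup>2 s\<close> nodes in each of \<open>d - 1\<close> layers.
\<close>

subsection \<open>Rank normal form\<close>

text \<open>Gaussian elimination by induction on the size: a nonzero entry is swapped into the
  corner, its row and column are cleared, and the induction hypothesis treats the rest.\<close>

lemma rank_normal_form:
  fixes A :: "'a::field mat"
  assumes "A \<in> carrier_mat n n"
  shows "\<exists>P Q r. P \<in> carrier_mat n n \<and> Q \<in> carrier_mat n n \<and> det P \<noteq> 0 \<and> det Q \<noteq> 0 \<and> r \<le> n \<and>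
    P * A * Q = mat n n (\<lambda>(i, j). if i = j \<and> i < r then 1 else 0)"
  using assms
proof (induction n arbitrary: A)
  case 0
  then show ?case
    by (intro exI[of _ "1\<^sub>m 0"] exI[of _ 0]) (auto intro!: eq_matI)
next
  case (Suc n)
  show ?case
  proof (cases "A = 0\<^sub>m (Suc n) (Suc n)")
    case True
    then show ?thesis
      by (intro exI[of _ "1\<^sub>m (Suc n)"] exI[of _ 0]) (auto intro!: eq_matI)
  next
    case False
    then obtain i j where ij: "i < Suc n" "j < Suc n" "A $$ (i, j) \<noteq> 0"
      using Suc.prems by (metis carrier_matD eq_matI index_zero_mat)
    define S where "S k = (if k = 0 then 1\<^sub>m (Suc n) else swaprows_mat (Suc n) 0 k :: 'a mat)" for k
    have S: "S k \<in> carrier_mat (Suc n) (Suc n)" "k < Suc n \<Longrightarrow> det (S k) \<noteq> 0" for k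
      by (auto simp: S_def det_swaprows_mat)
    define B where "B = S i * A * S j"
    define a where "a = B $$ (0, 0)"
    have B: "B \<in> carrier_mat (Suc n) (Suc n)"
      unfolding B_def using S Suc.prems by (intro mult_carrier_mat[of _ _ "Suc n"])
    have a: "a \<noteq> 0"
    proof -
      have swaprows0: "swaprows 0 0 C = C" and swapcols0: "swapcols 0 0 C = C" for C :: "'a mat"
        by (auto intro!: eq_matI)
      have "S i * A = swaprows 0 i A"
        using ij Suc.prems swaprows_mat[of A "Suc n" "Suc n" 0 i]
        by (cases "i = 0") (auto simp: S_def swaprows0)
      moreover have "C * S j = swapcols 0 j C" if "C \<in> carrier_mat (Suc n) (Suc n)" for C
        using ij that swapcols_mat[of C "Suc n" "Suc n" 0 j]
        by (cases "j = 0") (auto simp: S_def swapcols0)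
      ultimately have "B = swapcols 0 j (swaprows 0 i A)"
        using Suc.prems by (simp add: B_def)
      then show ?thesis
        using ij Suc.prems by (auto simp: a_def)
    qed
    define x y Z where "x = mat n 1 (\<lambda>(k, _). B $$ (Suc k, 0))"
      and "y = mat 1 n (\<lambda>(_, k). B $$ (0, Suc k))"
      and "Z = mat n n (\<lambda>(k, l). B $$ (Suc k, Suc l))"
    have xyZ: "x \<in> carrier_mat n 1" "y \<in> carrier_mat 1 n" "Z \<in> carrier_mat n n"
      by (auto simp: x_def y_def Z_def)
    let ?one = "1\<^sub>m 1 :: 'a mat"
    let ?J = "\<lambda>n r. mat n n (\<lambda>(i, j). if i = j \<and> i < r then 1 else 0 :: 'a)"
    have B_blocks: "B = four_block_mat (a \<cdot>\<^sub>m ?one) y x Z"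
      using B by (intro eq_matI) (auto simp: four_block_mat_def Let_def a_def x_def y_def Z_def)
    \<comment> \<open>The Schur complement of the pivot \<open>a\<close> in \<open>B\<close>;
      \<open>L1\<close> below clears the first column, \<open>R1\<close> clears the first row and
      normalises the pivot.\<close>
    define C where "C = (- inverse a) \<cdot>\<^sub>m x * y + Z"
    have C: "C \<in> carrier_mat n n"
      using xyZ by (auto simp: C_def)
    obtain P Q r where PQ: "P \<in> carrier_mat n n" "Q \<in> carrier_mat n n" "det P \<noteq> 0" "det Q \<noteq> 0"
      "r \<le> n" "P * C * Q = ?J n r"
      using Suc.IH[OF C] by blast
    define L1 where "L1 = four_block_mat ?one (0\<^sub>m 1 n) ((- inverse a) \<cdot>\<^sub>m x) (1\<^sub>m n)"
    define R1 where "R1 = four_block_mat (inverse a \<cdot>\<^sub>m ?one) ((- inverse a) \<cdot>\<^sub>m y) (0\<^sub>m n 1) (1\<^sub>m n)"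
    define L2 where "L2 = four_block_mat ?one (0\<^sub>m 1 n) (0\<^sub>m n 1) P"
    define R2 where "R2 = four_block_mat ?one (0\<^sub>m 1 n) (0\<^sub>m n 1) Q"
    have carr: "L1 \<in> carrier_mat (Suc n) (Suc n)" "R1 \<in> carrier_mat (Suc n) (Suc n)"
      "L2 \<in> carrier_mat (Suc n) (Suc n)" "R2 \<in> carrier_mat (Suc n) (Suc n)"
      using xyZ PQ by (auto simp: L1_def R1_def L2_def R2_def)
    have "L1 * B = four_block_mat (a \<cdot>\<^sub>m ?one) y (0\<^sub>m n 1) C"
      unfolding L1_def B_blocks using xyZ a
      by (subst mult_four_block_mat[of _ 1 1 _ n _ n _ _ 1 _ n])
        (auto simp: C_def intro!: arg_cong2[where f = "\<lambda>u v. four_block_mat u y v _"] eq_matI)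
    moreover have "four_block_mat (a \<cdot>\<^sub>m ?one) y (0\<^sub>m n 1) C * R1
        = four_block_mat ?one (0\<^sub>m 1 n) (0\<^sub>m n 1) C"
      unfolding R1_def using xyZ a C
      by (subst mult_four_block_mat[of _ 1 1 _ n _ n _ _ 1 _ n])
        (auto simp: mult_smult_assoc_mat[of _ 1 1 _ n] intro!: cong_four_block_mat eq_matI)
    moreover have "L2 * four_block_mat ?one (0\<^sub>m 1 n) (0\<^sub>m n 1) C
        = four_block_mat ?one (0\<^sub>m 1 n) (0\<^sub>m n 1) (P * C)"
      unfolding L2_def using PQ C
      by (subst mult_four_block_mat[of _ 1 1 _ n _ n _ _ 1 _ n])
        (auto intro!: cong_four_block_mat)
    moreover have "four_block_mat ?one (0\<^sub>m 1 n) (0\<^sub>m n 1) (P * C) * R2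
        = four_block_mat ?one (0\<^sub>m 1 n) (0\<^sub>m n 1) (P * C * Q)"
      unfolding R2_def using PQ C
      by (subst mult_four_block_mat[of _ 1 1 _ n _ n _ _ 1 _ n])
        (auto intro!: cong_four_block_mat)
    moreover have "four_block_mat ?one (0\<^sub>m 1 n) (0\<^sub>m n 1) (?J n r) = ?J (Suc n) (Suc r)"
      by (intro eq_matI) (auto simp: four_block_mat_def Let_def)
    ultimately have "L2 * (L1 * B * R1) * R2 = ?J (Suc n) (Suc r)"
      using PQ(6) by simp
    moreover have "L2 * (L1 * B * R1) * R2 = (L2 * L1 * S i) * A * (S j * R1 * R2)"
      unfolding B_def using carr S(1) Suc.prems
      by (simp add: assoc_mult_mat[of _ "Suc n" "Suc n" _ "Suc n" _ "Suc n"]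
          mult_carrier_mat[of _ "Suc n" "Suc n"])
    moreover have "det L1 = 1" "det R1 = inverse a" "det L2 = det P" "det R2 = det Q"
      unfolding L1_def R1_def L2_def R2_def using xyZ PQ
      by (simp_all add: det_four_block_mat_upper_right_zero[of _ 1 _ n]
          det_four_block_mat_lower_left_zero[of _ 1 _ n] det_single)
    ultimately show ?thesis
      using PQ(3-5) S carr a ij Suc.prems
      by (intro exI[of _ "L2 * L1 * S i"] exI[of _ "S j * R1 * R2"] exI[of _ "Suc r"])
        (auto simp: det_mult[of _ "Suc n"] mult_carrier_mat[of _ "Suc n" "Suc n"])
  qed
qed

subsection \<open>Determinants as products over closed walks\<close>

text \<open>Entries come from a total function, so leading blocks of all sizes share one
  \<open>a\<close>.\<close>

definition sqmat :: "nat \<Rightarrow> (nat \<Rightarrow> nat \<Rightarrow> 'a) \<Rightarrow> 'a mat"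
  where "sqmat n a = mat n n (\<lambda>(i, j). a i j)"

lemma sqmat_carrier [simp]: "sqmat n a \<in> carrier_mat n n"
  by (simp add: sqmat_def)

lemma det_sqmat:
  "det (sqmat n a) = (\<Sum>p | p permutes {0..<n}. signof p * (\<Prod>i\<in>{0..<n}. a i (p i)))"
  by (subst det_def'[OF sqmat_carrier])
    (auto simp: sqmat_def permutes_in_image intro!: sum.cong prod.cong
      arg_cong2[where f = "(*)"])

text \<open>The matrix maps the vector \<open>z\<close> to a multiple of the last unit vector.
  Multiplying by the adjugate and comparing last coordinates gives the claim, since the last
  diagonal cofactor is the leading minor.\<close>

lemma det_border:
  fixes a :: "nat \<Rightarrow> nat \<Rightarrow> 'a::comm_ring_1"
  assumes "z n = 1" and "\<And>i. i < n \<Longrightarrow> (\<Sum>j\<le>n. a i j * z j) = 0"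
  shows "det (sqmat (Suc n) a) = det (sqmat n a) * (\<Sum>j\<le>n. a n j * z j)"
proof -
  define A where "A = sqmat (Suc n) a"
  define x where "x = vec (Suc n) z"
  have A: "A \<in> carrier_mat (Suc n) (Suc n)" and x: "x \<in> carrier_vec (Suc n)"
    by (simp_all add: A_def x_def)
  have Ax: "vec_index (A *\<^sub>v x) i = (\<Sum>j\<le>n. a i j * z j)" if "i \<le> n" for i
    using that unfolding A_def x_def
    by (auto simp: sqmat_def scalar_prod_def atLeast0LessThan lessThan_Suc_atMost[symmetric])
  have "det A = vec_index ((det A \<cdot>\<^sub>m 1\<^sub>m (Suc n)) *\<^sub>v x) n"
    using x assms(1) by (simp add: x_def smult_scalar_prod_distrib[of _ "Suc n"])
  also have "(det A \<cdot>\<^sub>m 1\<^sub>m (Suc n)) *\<^sub>v x = adj_mat A *\<^sub>v (A *\<^sub>v x)"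
    using adj_mat[OF A] A x by (metis assoc_mult_mat_vec)
  also have "vec_index (adj_mat A *\<^sub>v (A *\<^sub>v x)) n
      = (\<Sum>i<Suc n. adj_mat A $$ (n, i) * vec_index (A *\<^sub>v x) i)"
    using adj_mat(1)[OF A] A x by (auto simp: scalar_prod_def intro!: sum.cong)
  also have "\<dots> = (\<Sum>i<Suc n. if i = n then adj_mat A $$ (n, n) * (\<Sum>j\<le>n. a n j * z j) else 0)"
    using Ax assms(2) by (intro sum.cong) auto
  also have "\<dots> = adj_mat A $$ (n, n) * (\<Sum>j\<le>n. a n j * z j)"
    by simp
  also have "adj_mat A $$ (n, n) = det (mat_delete A n n)"
    using A by (simp add: adj_mat_def cofactor_def)
  also have "mat_delete A n n = sqmat n a"
    by (auto simp: mat_delete_def A_def sqmat_def)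
  finally show ?thesis
    by (simp add: A_def)
qed

text \<open>
  The weight of the walks of length \<open>k\<close> from \<open>v\<close> to \<open>h\<close> through vertices \<open>\<le> h\<close> that visit \<open>h\<close>
  only at the end.
\<close>

primrec walk :: "(nat \<Rightarrow> nat \<Rightarrow> 'a::comm_ring_1) \<Rightarrow> nat \<Rightarrow> nat \<Rightarrow> nat \<Rightarrow> 'a" where
  "walk N h 0 v = (if v = h then 1 else 0)"
| "walk N h (Suc k) v = (if v = h then 0 else \<Sum>w\<le>h. N v w * walk N h k w)"

definition walk_series :: "(nat \<Rightarrow> nat \<Rightarrow> 'a::comm_ring_1) \<Rightarrow> nat \<Rightarrow> nat \<Rightarrow> 'a fps"
  where "walk_series N h v = Abs_fps (\<lambda>k. walk N h k v)"

definition loop_factor :: "(nat \<Rightarrow> nat \<Rightarrow> 'a::comm_ring_1) \<Rightarrow> nat \<Rightarrow> 'a fps"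
  where "loop_factor N h = 1 - fps_X * (\<Sum>w\<le>h. fps_const (N h w) * walk_series N h w)"

definition one_minus :: "(nat \<Rightarrow> nat \<Rightarrow> 'a::comm_ring_1) \<Rightarrow> nat \<Rightarrow> nat \<Rightarrow> 'a fps"
  where "one_minus N i j = (if i = j then 1 else 0) - fps_X * fps_const (N i j)"

lemma walk_series_head: "walk_series N h h = 1"
proof (rule fps_ext)
  show "fps_nth (walk_series N h h) k = fps_nth 1 k" for k
    by (cases k) (auto simp: walk_series_def)
qed

lemma walk_series_step:
  assumes "v \<noteq> h"
  shows "walk_series N h v = fps_X * (\<Sum>w\<le>h. fps_const (N v w) * walk_series N h w)"
proof (rule fps_ext)
  show "fps_nth (walk_series N h v) k =
    fps_nth (fps_X * (\<Sum>w\<le>h. fps_const (N v w) * walk_series N h w)) k" for k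
    using assms by (cases k) (auto simp: walk_series_def fps_sum_nth)
qed

lemma sum_one_minus:
  assumes "v \<le> h"
  shows "(\<Sum>j\<le>h. one_minus N v j * y j) = y v - fps_X * (\<Sum>w\<le>h. fps_const (N v w) * y w)"
  using assms
  by (simp add: one_minus_def left_diff_distrib sum_subtractf sum_distrib_left mult.assoc
      if_distrib[of "\<lambda>c. c * _"] cong: if_cong)

text \<open>Splitting off the first step of a walk shows that the rows \<open>i < h\<close>
  annihilate the vector \<open>walk_series N h\<close>, whose entry at \<open>h\<close> is 1. Row
  \<open>h\<close> maps it to \<open>loop_factor N h\<close>, so \<open>det_border\<close>
  applies.\<close>

lemma det_one_minus_Suc:
  "det (sqmat (Suc h) (one_minus N)) = det (sqmat h (one_minus N)) * loop_factor N h"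
proof -
  have "(\<Sum>j\<le>h. one_minus N i j * walk_series N h j) = 0" if "i < h" for i
    using that walk_series_step[of i h N] by (simp add: sum_one_minus)
  then have "det (sqmat (Suc h) (one_minus N)) =
      det (sqmat h (one_minus N)) * (\<Sum>j\<le>h. one_minus N h j * walk_series N h j)"
    by (intro det_border walk_series_head)
  then show ?thesis
    by (simp add: sum_one_minus loop_factor_def walk_series_head)
qed

lemma det_one_minus:
  assumes "r \<le> s"
  shows "det (sqmat s (one_minus N)) =
    det (sqmat r (one_minus N)) * (\<Prod>i\<in>{r..<s}. loop_factor N i)"
  using assms
  by (induction s rule: dec_induct) (auto simp: det_one_minus_Suc mult.assoc)

section \<open>Recurrence for the product of the loop factors\<close>

definition walk_product :: "(nat \<Rightarrow> nat \<Rightarrow> 'a::comm_ring_1) \<Rightarrow> nat \<Rightarrow> nat \<Rightarrow> nat \<Rightarrow> 'a fps"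
  where "walk_product N s h v = walk_series N h v * (\<Prod>i\<in>{Suc h..<s}. loop_factor N i)"

text \<open>Expanding the product selects 1 or a negated closed walk from each factor. The terms are
  sorted by the smallest head \<open>i\<close> with a walk selected; the factors of larger heads
  stay intact inside \<open>walk_product N s i w\<close>.\<close>

lemma loop_product:
  assumes "h \<le> s"
  shows "(\<Prod>i\<in>{h..<s}. loop_factor N i) =
    1 - fps_X * (\<Sum>i\<in>{h..<s}. \<Sum>w\<le>i. fps_const (N i w) * walk_product N s i w)"
  using assms
proof (induction h rule: inc_induct)
  case base
  then show ?case by simp
next
  case (step h)
  let ?P = "\<Prod>i\<in>{Suc h..<s}. loop_factor N i"
  have "(\<Prod>i\<in>{h..<s}. loop_factor N i) = loop_factor N h * ?P"
    using step.hyps by (simp add: prod.atLeast_Suc_lessThan)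
  also have "\<dots> = ?P - fps_X * (\<Sum>w\<le>h. fps_const (N h w) * walk_product N s h w)"
    by (simp add: loop_factor_def walk_product_def left_diff_distrib sum_distrib_right mult.assoc)
  finally show ?case
    unfolding step.IH using step.hyps by (simp add: sum.atLeast_Suc_lessThan distrib_left)
qed

lemma walk_product_0: "h \<le> s \<Longrightarrow> fps_nth (walk_product N s h v) 0 = (if v = h then 1 else 0)"
  by (cases "Suc h \<le> s")
    (simp_all add: walk_product_def walk_series_def loop_product)

text \<open>The walk at \<open>h\<close> is closed, so the next step opens one at a larger head.
  With \<open>walk_product_step\<close> this is a linear recurrence in the power of
  \<open>fps_X\<close>, the source of the transitions of the branching program.\<close>

lemma walk_product_head:
  assumes "h < s"
  shows "fps_nth (walk_product N s h h) (Suc k) =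
    - (\<Sum>i\<in>{Suc h..<s}. \<Sum>w\<le>i. N i w * fps_nth (walk_product N s i w) k)"
proof -
  have "walk_product N s h h =
      1 - fps_X * (\<Sum>i\<in>{Suc h..<s}. \<Sum>w\<le>i. fps_const (N i w) * walk_product N s i w)"
    using assms loop_product[of "Suc h" s N] by (simp add: walk_product_def walk_series_head)
  then show ?thesis
    by (simp add: fps_sum_nth)
qed

lemma walk_product_step:
  assumes "v \<noteq> h"
  shows "fps_nth (walk_product N s h v) (Suc k) =
    (\<Sum>w\<le>h. N v w * fps_nth (walk_product N s h w) k)"
proof -
  have "walk_product N s h v = fps_X * (\<Sum>w\<le>h. fps_const (N v w) * walk_product N s h w)"
    unfolding walk_product_def
    by (subst walk_series_step[OF assms]) (simp add: sum_distrib_right mult.assoc)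
  then show ?thesis
    by (simp add: fps_sum_nth)
qed

subsection \<open>Coefficients of the inner variable\<close>

definition inner_coeff :: "nat \<Rightarrow> 'a::comm_ring_1 poly fps \<Rightarrow> 'a fps"
  where "inner_coeff t g = Abs_fps (\<lambda>k. coeff (fps_nth g k) t)"

lemma nth_inner_coeff [simp]: "fps_nth (inner_coeff t g) k = coeff (fps_nth g k) t"
  by (simp add: inner_coeff_def)

lemma inner_coeff_mult: "inner_coeff t (g * h) = (\<Sum>i\<le>t. inner_coeff i g * inner_coeff (t - i) h)"
proof (rule fps_ext)
  fix k
  have "fps_nth (inner_coeff t (g * h)) k =
      (\<Sum>j=0..k. \<Sum>i\<le>t. coeff (fps_nth g j) i * coeff (fps_nth h (k - j)) (t - i))"
    by (simp add: fps_mult_nth coeff_sum coeff_mult)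
  also have "\<dots> = fps_nth (\<Sum>i\<le>t. inner_coeff i g * inner_coeff (t - i) h) k"
    by (subst sum.swap) (simp add: fps_mult_nth fps_sum_nth)
  finally show "fps_nth (inner_coeff t (g * h)) k =
    fps_nth (\<Sum>i\<le>t. inner_coeff i g * inner_coeff (t - i) h) k" .
qed

lemma inner_coeff_simps [simp]:
  "inner_coeff t (g + h) = inner_coeff t g + inner_coeff t h"
  "inner_coeff t (- g) = - inner_coeff t g"
  "inner_coeff t (g - h) = inner_coeff t g - inner_coeff t h"
  "inner_coeff t 0 = 0"
  "inner_coeff t 1 = (if t = 0 then 1 else 0)"
  "inner_coeff t (fps_X * g) = fps_X * inner_coeff t g"
  "inner_coeff t (fps_const p) = fps_const (coeff p t)"
  by (auto intro!: fps_ext simp: coeff_1)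

lemma inner_coeff_sum: "inner_coeff t (\<Sum>i\<in>I. g i) = (\<Sum>i\<in>I. inner_coeff t (g i))"
  by (induction I rule: infinite_finite_induct) simp_all

lemma inner_coeff_signof: "inner_coeff t (signof p * g) = signof p * inner_coeff t g"
  by (simp add: sign_def)

definition inner_degree_le :: "nat \<Rightarrow> 'a::comm_ring_1 poly fps \<Rightarrow> bool"
  where "inner_degree_le n g \<longleftrightarrow> (\<forall>t>n. inner_coeff t g = 0)"

text \<open>In the convolution for index \<open>m + n\<close> only the product of the two top
  coefficients survives; beyond that index nothing does.\<close>

lemma inner_degree_le_mult:
  assumes "inner_degree_le m g" "inner_degree_le n h"
  shows "inner_degree_le (m + n) (g * h)"
    and "inner_coeff (m + n) (g * h) = inner_coeff m g * inner_coeff n h"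
proof -
  have zero: "inner_coeff i g * inner_coeff (t - i) h = 0"
    if "m + n \<le> t" "i \<noteq> m \<or> m + n < t" for t i
    using assms that by (cases "m < i") (auto simp: inner_degree_le_def)
  show "inner_degree_le (m + n) (g * h)"
    unfolding inner_degree_le_def inner_coeff_mult by (auto intro!: sum.neutral zero)
  have "inner_coeff (m + n) (g * h) =
      (\<Sum>i\<le>m + n. if i = m then inner_coeff m g * inner_coeff n h else 0)"
    unfolding inner_coeff_mult by (intro sum.cong) (auto intro!: zero)
  then show "inner_coeff (m + n) (g * h) = inner_coeff m g * inner_coeff n h"
    by simp
qed

lemma inner_degree_le_prod:
  assumes "finite I" "\<And>i. i \<in> I \<Longrightarrow> inner_degree_le (m i) (g i)"
  shows "inner_degree_le (\<Sum>i\<in>I. m i) (\<Prod>i\<in>I. g i) \<and>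
    inner_coeff (\<Sum>i\<in>I. m i) (\<Prod>i\<in>I. g i) = (\<Prod>i\<in>I. inner_coeff (m i) (g i))"
  using assms
proof (induction I rule: finite_induct)
  case empty
  then show ?case by (simp add: inner_degree_le_def)
next
  case (insert i I)
  then show ?case
    using inner_degree_le_mult[of "m i" "g i" "sum m I" "prod g I"] by auto
qed

text \<open>Each Leibniz term takes one entry from every row, so row bounds add up and the top
  coefficient is extracted row by row.\<close>

lemma inner_coeff_det:
  assumes "\<And>i j. i < n \<Longrightarrow> inner_degree_le (m i) (a i j)"
  shows "inner_degree_le (\<Sum>i<n. m i) (det (sqmat n a))"
    and "inner_coeff (\<Sum>i<n. m i) (det (sqmat n a)) = det (sqmat n (\<lambda>i j. inner_coeff (m i) (a i j)))"
proof -
  have "inner_degree_le (\<Sum>i<n. m i) (\<Prod>i\<in>{0..<n}. a i (p i)) \<and>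
    inner_coeff (\<Sum>i<n. m i) (\<Prod>i\<in>{0..<n}. a i (p i)) =
      (\<Prod>i\<in>{0..<n}. inner_coeff (m i) (a i (p i)))" for p
    using inner_degree_le_prod[of "{0..<n}" m "\<lambda>i. a i (p i)"] assms
    by (simp add: atLeast0LessThan)
  then show "inner_degree_le (\<Sum>i<n. m i) (det (sqmat n a))"
    and "inner_coeff (\<Sum>i<n. m i) (det (sqmat n a)) = det (sqmat n (\<lambda>i j. inner_coeff (m i) (a i j)))"
    by (simp_all add: det_sqmat inner_degree_le_def inner_coeff_sum inner_coeff_signof)
qed

text \<open>In the nested ring of series over polynomials, \<open>fps_X\<close> is \<open>u\<close> and the inner variable is \<open>z\<close>.\<close>

definition mark_rows :: "nat \<Rightarrow> (nat \<Rightarrow> nat \<Rightarrow> 'a::comm_ring_1) \<Rightarrow> nat \<Rightarrow> nat \<Rightarrow> 'a poly"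
  where "mark_rows r N v w = monom (N v w) (if v < r then 0 else 1)"

lemma top_coeff_loop_product:
  fixes N :: "nat \<Rightarrow> nat \<Rightarrow> 'a::comm_ring_1"
  assumes "r \<le> s"
    and det: "det (sqmat s (\<lambda>i j. (if i = j \<and> i < r then 1 else 0) - fps_X * fps_const (N i j))) =
      fps_const f * fps_X ^ d"
  shows "coeff (fps_nth (\<Prod>i\<in>{r..<s}. loop_factor (mark_rows r N) i) d) (s - r) = f"
proof -
  define H where "H = one_minus (mark_rows r N)"
  define D where "D = det (sqmat r H)"
  define P where "P = (\<Prod>i\<in>{r..<s}. loop_factor (mark_rows r N) i)"
  define m where "m i = (if i < r then 0 else 1 :: nat)" for i
  have deg: "inner_degree_le (m i) (H i j)" for i j
    by (auto simp: inner_degree_le_def H_def one_minus_def mark_rows_def m_def)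
  have "(\<Sum>i<s. m i) = (\<Sum>i\<in>{r..<s}. 1)"
    by (rule sum.mono_neutral_cong_right) (auto simp: m_def)
  then have m_s: "(\<Sum>i<s. m i) = s - r" and m_r: "(\<Sum>i<r. m i) = 0"
    by (simp_all add: m_def)
  \<comment> \<open>In a marked row the coefficient of \<open>z\<close> drops the diagonal 1 and
    keeps \<open>- u N\<close>; this turns the identity into \<open>J\<close>.\<close>
  have "fps_const f * fps_X ^ d = inner_coeff (s - r) (det (sqmat s H))"
    unfolding det[symmetric] m_s[symmetric] inner_coeff_det(2)[OF deg]
    by (intro arg_cong[where f = det] arg_cong[where f = "sqmat s"] ext)
      (auto simp: H_def one_minus_def mark_rows_def m_def)
  also have "\<dots> = inner_coeff (s - r) (D * P)"
    by (simp add: H_def D_def P_def det_one_minus[OF assms(1)])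
  also have "\<dots> = inner_coeff 0 D * inner_coeff (s - r) P"
  proof -
    have "inner_coeff i D = 0" if "i > 0" for i
      using inner_coeff_det(1)[of r m H, OF deg] that by (simp add: m_r D_def inner_degree_le_def)
    then have "(\<Sum>i\<le>s - r. inner_coeff i D * inner_coeff (s - r - i) P) =
        (\<Sum>i\<le>s - r. if i = 0 then inner_coeff 0 D * inner_coeff (s - r) P else 0)"
      by (intro sum.cong) auto
    then show ?thesis
      by (simp add: inner_coeff_mult)
  qed
  finally have eq: "inner_coeff 0 D * inner_coeff (s - r) P = fps_const f * fps_X ^ d" ..
  have D0: "fps_nth (inner_coeff 0 D) 0 = 1"
  proof -
    interpret comm_ring_hom "\<lambda>g :: 'a poly fps. fps_nth g 0"
      by unfold_locales simp_all
    have "fps_nth D 0 = det (map_mat (\<lambda>g. fps_nth g 0) (sqmat r H))"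
      by (simp add: D_def)
    also have "map_mat (\<lambda>g. fps_nth g 0) (sqmat r H) = 1\<^sub>m r"
      by (auto simp: sqmat_def H_def one_minus_def)
    finally show ?thesis by simp
  qed
  \<comment> \<open>The constant term of \<open>inner_coeff 0 D\<close> is 1, so multiplying by it
    preserves the first coefficient after a run of zeros. The induction below thus transfers the
    vanishing below \<open>d\<close> from the product to \<open>P\<close>.\<close>
  have expand: "fps_nth (inner_coeff 0 D * inner_coeff (s - r) P) k = fps_nth (inner_coeff (s - r) P) k"
    if "\<And>j. j < k \<Longrightarrow> fps_nth (inner_coeff (s - r) P) j = 0" for k
  proof -
    have "fps_nth (inner_coeff 0 D * inner_coeff (s - r) P) k =
        (\<Sum>i=0..k. if i = 0 then fps_nth (inner_coeff (s - r) P) k else 0)"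
      unfolding fps_mult_nth using that D0 by (intro sum.cong) auto
    then show ?thesis by simp
  qed
  have "fps_nth (inner_coeff (s - r) P) k = 0" if "k < d" for k
    using that
  proof (induction k rule: less_induct)
    case (less k)
    then show ?case
      using expand[of k] by (simp add: eq)
  qed
  then show ?thesis
    using expand[of d] by (simp add: eq flip: P_def)
qed

subsection \<open>Homogeneous polynomials\<close>

lemma comm_ring_hom_Const: "comm_ring_hom (Const :: 'a::comm_ring_1 \<Rightarrow> 'a mpoly)"
  by unfold_locales (simp_all add: Const_def single_add mult_single)

interpretation Const: comm_ring_hom "Const :: 'a::comm_ring_1 \<Rightarrow> 'a mpoly"
  by (rule comm_ring_hom_Const)

lemma hom_linear_functions_0: "0 \<in> hom_linear_functions n"
  unfolding hom_linear_functions_def by (auto intro!: exI[of _ "\<lambda>_. 0"])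

lemma hom_linear_functions_add:
  assumes "p \<in> hom_linear_functions n" "q \<in> hom_linear_functions n"
  shows "p + q \<in> hom_linear_functions n"
proof -
  obtain a b where "p = (\<Sum>i<n. Const (a i) * Var i)" "q = (\<Sum>i<n. Const (b i) * Var i)"
    using assms by (auto simp: hom_linear_functions_def)
  then have "p + q = (\<Sum>i<n. Const (a i + b i) * Var i)"
    by (simp add: Const.hom_add distrib_right sum.distrib)
  then show ?thesis
    by (auto simp: hom_linear_functions_def)
qed

lemma hom_linear_functions_scale:
  assumes "p \<in> hom_linear_functions n"
  shows "Const c * p \<in> hom_linear_functions n"
proof -
  obtain a where "p = (\<Sum>i<n. Const (a i) * Var i)"
    using assms by (auto simp: hom_linear_functions_def)
  then have "Const c * p = (\<Sum>i<n. Const (c * a i) * Var i)"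
    by (simp add: Const.hom_mult sum_distrib_left mult.assoc)
  then show ?thesis
    by (auto simp: hom_linear_functions_def)
qed

lemma hom_linear_functions_uminus: "p \<in> hom_linear_functions n \<Longrightarrow> - p \<in> hom_linear_functions n"
  using hom_linear_functions_scale[of p n "- 1"] by (simp add: Const.hom_uminus)

lemma hom_linear_functions_sum:
  "(\<And>i. i \<in> I \<Longrightarrow> g i \<in> hom_linear_functions n) \<Longrightarrow> (\<Sum>i\<in>I. g i) \<in> hom_linear_functions n"
  by (induction I rule: infinite_finite_induct)
    (simp_all add: hom_linear_functions_0 hom_linear_functions_add)

lemma monom_degree_plus: "monom_degree (m + m') = monom_degree m + monom_degree m'"
proof -
  have eq: "monom_degree k = (\<Sum>i\<in>S. Poly_Mapping.lookup k i)"
    if "finite S" "Poly_Mapping.keys k \<subseteq> S" for k S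
    unfolding monom_degree_def using that
    by (intro sum.mono_neutral_left) (auto simp: in_keys_iff)
  define S where "S = Poly_Mapping.keys m \<union> Poly_Mapping.keys m'"
  have "Poly_Mapping.keys (m + m') \<subseteq> S"
    using Poly_Mapping.keys_add[of m m'] by (simp add: S_def)
  then show ?thesis
    using eq[of S] by (simp add: S_def lookup_add sum.distrib)
qed

lemma homogeneous_0: "homogeneous k 0"
  by (simp add: homogeneous_def)

lemma homogeneous_add: "homogeneous k p \<Longrightarrow> homogeneous k q \<Longrightarrow> homogeneous k (p + q)"
  using Poly_Mapping.keys_add[of p q] by (auto simp: homogeneous_def)

lemma homogeneous_uminus:
  fixes p :: "'a::ring_1 mpoly"
  shows "homogeneous k p \<Longrightarrow> homogeneous k (- p)"
  by (simp add: homogeneous_def in_keys_iff)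

lemma homogeneous_mult:
  fixes p q :: "'a::comm_ring_1 mpoly"
  shows "homogeneous k p \<Longrightarrow> homogeneous l q \<Longrightarrow> homogeneous (k + l) (p * q)"
  using keys_mult[of p q] by (fastforce simp: homogeneous_def monom_degree_plus)

lemma homogeneous_sum: "(\<And>i. i \<in> I \<Longrightarrow> homogeneous k (g i)) \<Longrightarrow> homogeneous k (\<Sum>i\<in>I. g i)"
  by (induction I rule: infinite_finite_induct) (simp_all add: homogeneous_0 homogeneous_add)

lemma homogeneous_Const: "homogeneous 0 (Const c)"
  by (simp add: homogeneous_def Const_def monom_degree_def)

lemma homogeneous_Var: "homogeneous 1 (Var i :: 'a::zero_neq_one mpoly)"
  by (simp add: homogeneous_def Var_def monom_degree_def)

lemma homogeneous_hom_linear: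
  "p \<in> hom_linear_functions n \<Longrightarrow> homogeneous 1 p"
  using homogeneous_mult[OF homogeneous_Const homogeneous_Var]
  by (auto simp: hom_linear_functions_def intro!: homogeneous_sum)

section \<open>Homogenization by a grading variable\<close>

definition graded_poly :: "'a::comm_ring_1 mpoly poly \<Rightarrow> bool"
  where "graded_poly p \<longleftrightarrow> (\<forall>k. homogeneous k (coeff p k))"

lemma graded_poly_mult: "graded_poly p \<Longrightarrow> graded_poly q \<Longrightarrow> graded_poly (p * q)"
  unfolding graded_poly_def coeff_mult
  by (metis (no_types, lifting) homogeneous_mult homogeneous_sum atMost_iff le_add_diff_inverse)

lemma graded_poly_1: "graded_poly (1 :: 'a::comm_ring_1 mpoly poly)"
  using homogeneous_Const[of "1 :: 'a"] by (simp add: graded_poly_def coeff_1 homogeneous_0)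

lemma graded_poly_uminus: "graded_poly p \<Longrightarrow> graded_poly (- p)"
  by (simp add: graded_poly_def homogeneous_uminus)

lemma graded_poly_sum: "(\<And>i. i \<in> I \<Longrightarrow> graded_poly (g i)) \<Longrightarrow> graded_poly (\<Sum>i\<in>I. g i)"
  by (simp add: graded_poly_def coeff_sum homogeneous_sum)

lemma graded_poly_prod: "(\<And>i. i \<in> I \<Longrightarrow> graded_poly (g i)) \<Longrightarrow> graded_poly (\<Prod>i\<in>I. g i)"
  by (induction I rule: infinite_finite_induct) (simp_all add: graded_poly_1 graded_poly_mult)

lemma graded_poly_det:
  assumes "\<And>i j. i < n \<Longrightarrow> j < n \<Longrightarrow> graded_poly (a i j)"
  shows "graded_poly (det (sqmat n a))"
  unfolding det_sqmat
proof (rule graded_poly_sum)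
  fix p assume p: "p \<in> {p. p permutes {0..<n}}"
  then have "p i < n" if "i < n" for i
    using that permutes_in_image[of p "{0..<n}" i] by simp
  then have "graded_poly (\<Prod>i\<in>{0..<n}. a i (p i))"
    by (intro graded_poly_prod assms) auto
  then show "graded_poly (signof p * (\<Prod>i\<in>{0..<n}. a i (p i)))"
    by (simp add: sign_def graded_poly_uminus)
qed

text \<open>Evaluation at 1 adds up the coefficients; being homogeneous of different degrees, they
  are recovered as the homogeneous components of the value.\<close>

lemma graded_poly_eq_monom:
  assumes "graded_poly p" and "homogeneous d (poly p 1)"
  shows "p = monom (poly p 1) d"
proof -
  have *: "Poly_Mapping.lookup (coeff p k) m =
    (if monom_degree m = k then Poly_Mapping.lookup (poly p 1) m else 0)" for k m
  proof -
    have zero: "Poly_Mapping.lookup (coeff p i) m = 0" if "monom_degree m \<noteq> i" for i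
      using assms(1) that by (metis graded_poly_def homogeneous_def in_keys_iff)
    have "Poly_Mapping.lookup (poly p 1) m = (\<Sum>i\<le>degree p. Poly_Mapping.lookup (coeff p i) m)"
      by (simp add: poly_altdef lookup_sum)
    also have "\<dots> = (\<Sum>i\<le>degree p.
        if i = monom_degree m then Poly_Mapping.lookup (coeff p i) m else 0)"
      using zero by (intro sum.cong) auto
    also have "\<dots> = Poly_Mapping.lookup (coeff p (monom_degree m)) m"
      by (auto simp: coeff_eq_0)
    finally show ?thesis
      using zero by auto
  qed
  have "Poly_Mapping.lookup (poly p 1) m = 0" if "monom_degree m \<noteq> d" for m
    using assms(2) that by (metis homogeneous_def in_keys_iff)
  then show ?thesis
    by (intro poly_eqI poly_mapping_eqI) (auto simp: *)
qed

text \<open>Scaling only the linear parts by a variable gives a graded polynomial with value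
  \<open>f\<close> at 1, hence a monomial. The argument runs in polynomials, where evaluation at 1
  makes sense, and is then mapped to series.\<close>

lemma det_homogenize:
  assumes L: "\<And>i j. i < s \<Longrightarrow> j < s \<Longrightarrow> L i j \<in> hom_linear_functions n"
    and f: "det (sqmat s (\<lambda>i j. Const (c i j) + L i j)) = f" "homogeneous d f"
  shows "det (sqmat s (\<lambda>i j. fps_const (Const (c i j)) + fps_X * fps_const (L i j))) =
    fps_const f * fps_X ^ d"
proof -
  define a where "a i j = [:Const (c i j), L i j:]" for i j
  define p where "p = det (sqmat s a)"
  have "graded_poly (a i j)" if "i < s" "j < s" for i j
    using homogeneous_hom_linear[OF L[OF that]]
    by (auto simp: graded_poly_def a_def coeff_pCons homogeneous_0 homogeneous_Const split: nat.splits)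
  then have graded: "graded_poly p"
    unfolding p_def by (rule graded_poly_det)
  have "poly p 1 = f"
  proof -
    interpret comm_ring_hom "\<lambda>q :: 'a mpoly poly. poly q 1"
      by unfold_locales simp_all
    have "map_mat (\<lambda>q. poly q 1) (sqmat s a) = sqmat s (\<lambda>i j. Const (c i j) + L i j)"
      by (auto simp: sqmat_def a_def)
    then show ?thesis
      using hom_det[of "sqmat s a"] f(1) by (simp add: p_def)
  qed
  then have p: "p = monom f d"
    using graded_poly_eq_monom[OF graded] f(2) by metis
  interpret comm_ring_hom "fps_of_poly :: 'a mpoly poly \<Rightarrow> _"
    by unfold_locales (simp_all add: fps_of_poly_add fps_of_poly_mult)
  have "map_mat fps_of_poly (sqmat s a) =
      sqmat s (\<lambda>i j. fps_const (Const (c i j)) + fps_X * fps_const (L i j))"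
    by (auto simp: sqmat_def a_def fps_of_poly_pCons mult.commute)
  then show ?thesis
    using hom_det[of "sqmat s a"] p by (simp add: p_def fps_of_poly_monom)
qed

text \<open>Rows from \<open>r\<close> on have no constant part, so \<open>fps_X ^ (s - r)\<close>
  divides every Leibniz term; the nonzero coefficient at \<open>d\<close> forbids
  \<open>d < s - r\<close>.\<close>

lemma corank_le_order:
  fixes f :: "'a::comm_ring_1"
  assumes "det (sqmat s (\<lambda>i j. (if i = j \<and> i < r then 1 else 0) - fps_X * fps_const (N i j))) =
      fps_const f * fps_X ^ d"
    and "f \<noteq> 0"
  shows "s - r \<le> d"
proof -
  define a where "a i j = (if i = j \<and> i < r then 1 else 0) - fps_X * fps_const (N i j)" for i j
  have "fps_X ^ (s - r) dvd det (sqmat s a)"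
    unfolding det_sqmat
  proof (intro dvd_sum dvd_mult)
    fix p :: "nat \<Rightarrow> nat"
    have "fps_X ^ (s - r) = (\<Prod>i\<in>{r..<s}. fps_X :: 'a fps)"
      by simp
    also have "\<dots> dvd (\<Prod>i\<in>{r..<s}. a i (p i))"
      by (intro prod_dvd_prod) (auto simp: a_def)
    also have "\<dots> dvd (\<Prod>i\<in>{0..<s}. a i (p i))"
      by (intro prod_dvd_prod_subset) auto
    finally show "fps_X ^ (s - r) dvd (\<Prod>i\<in>{0..<s}. a i (p i))" .
  qed
  then obtain g where g: "fps_const f * fps_X ^ d = fps_X ^ (s - r) * g"
    unfolding a_def assms(1) by (auto elim: dvdE)
  have "fps_nth (fps_const f * fps_X ^ d) d = f"
    by simp
  then show ?thesis
    using assms(2) unfolding g by (auto simp: fps_X_power_mult_nth split: if_splits)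
qed

subsection \<open>Homogeneous branching programs\<close>

text \<open>All \<open>k + 1\<close> layers are copies of \<open>S\<close> and all \<open>k\<close>
  matrices are \<open>T\<close>, so the program iterates the recurrence.\<close>

lemma habp_le_recurrence:
  assumes "finite S"
    and T: "\<And>p q. T p q \<in> hom_linear_functions n"
    and b: "\<And>q. b q \<in> hom_linear_functions n"
    and y0: "\<And>q. q \<in> S \<Longrightarrow> y q 0 = Const (c q)"
    and y_Suc: "\<And>q k. q \<in> S \<Longrightarrow> y q (Suc k) = (\<Sum>p\<in>S. T q p * y p k)"
    and f: "f = (\<Sum>q\<in>S. b q * y q (Suc k))"
  shows "habp n f \<le> enat (Suc k * card S)"
proof -
  define m where "m = card S"
  obtain h where h: "bij_betw h {..<m} S"
    using ex_bij_betw_nat_finite[OF \<open>finite S\<close>] by (auto simp: m_def atLeast0LessThan)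
  then have h_in: "h i \<in> S" if "i < m" for i
    using that by (auto simp: bij_betw_def)
  define M where "M = sqmat m (\<lambda>i j. T (h i) (h j))"
  define Y where "Y j = vec m (\<lambda>i. y (h i) j)" for j
  have "M *\<^sub>v Y j = Y (Suc j)" for j
  proof -
    have "(\<Sum>l<m. T (h i) (h l) * y (h l) j) = y (h i) (Suc j)" if "i < m" for i
      using sum.reindex_bij_betw[OF h, of "\<lambda>p. T (h i) p * y p j"] y_Suc[OF h_in[OF that]] by simp
    then show ?thesis
      by (intro eq_vecI) (auto simp: M_def Y_def sqmat_def scalar_prod_def atLeast0LessThan)
  qed
  then have foldr_eq: "foldr (\<lambda>i v. M *\<^sub>v v) xs (Y j) = Y (j + length xs)" for xs :: "nat list" and j
    by (induction xs) simp_all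
  \<comment> \<open>The last vector is \<open>Y 1\<close>, not \<open>Y 0\<close>: the entries of
    \<open>Y 0\<close> are constants, and one transition turns them into homogeneous linear
    forms.\<close>
  have prod: "f = abp_product k (vec m (b \<circ> h)) (\<lambda>_. M) (Y 1)"
    using sum.reindex_bij_betw[OF h, of "\<lambda>q. b q * y q (Suc k)"]
    unfolding abp_product_def foldr_eq f
    by (simp add: scalar_prod_def Y_def atLeast0LessThan del: upt_Suc)
  have "y q 1 \<in> hom_linear_functions n" if "q \<in> S" for q
  proof -
    have "y q 1 = (\<Sum>p\<in>S. Const (c p) * T q p)"
      using y_Suc[OF that, of 0] y0 by (simp add: mult.commute)
    then show ?thesis
      by (simp add: hom_linear_functions_sum hom_linear_functions_scale T)
  qed
  then have "set\<^sub>v (Y 1) \<subseteq> hom_linear_functions n"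
    using h_in by (auto simp: Y_def vec_set_def)
  moreover have "set\<^sub>v (vec m (b \<circ> h)) \<subseteq> hom_linear_functions n"
    using b by (auto simp: vec_set_def)
  moreover have "elements_mat M \<subseteq> hom_linear_functions n"
    using T by (auto simp: M_def sqmat_def elements_mat_def)
  ultimately have "has_abp (hom_linear_functions n) m (Suc k * m) f"
    unfolding has_abp_def
    by (intro exI[of _ k] exI[of _ "\<lambda>_. m"] exI[of _ "vec m (b \<circ> h)"] exI[of _ "\<lambda>_. M"] exI[of _ "Y 1"])
      (auto simp: prod M_def Y_def)
  then show ?thesis
    unfolding habp_def m_def by (intro Inf_lower) blast
qed

text \<open>Gives the coefficient the shape of a sum over states \<open>u < e\<close>. A marked row
  lowers the power by one, so there even \<open>t = e\<close> leads to a power below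
  \<open>e\<close>.\<close>

lemma coeff_mark_rows_mult:
  assumes "if v < r then t < e else t \<le> e"
  shows "coeff (mark_rows r N v w * p) t =
    (\<Sum>u<e. if t = (if v < r then u else Suc u) then N v w * coeff p u else 0)"
proof (cases "v < r")
  case True
  then show ?thesis
    using assms by (simp add: mark_rows_def coeff_monom_mult)
next
  case False
  have "(\<Sum>u<e. if t = Suc u then N v w * coeff p u else 0) =
      (\<Sum>u<e. if u = t - 1 \<and> 0 < t then N v w * coeff p u else 0)"
    by (intro sum.cong) auto
  then show ?thesis
    using False assms by (cases t) (simp_all add: mark_rows_def coeff_monom_mult)
qed

lemma habp_le_corank:
  assumes N: "\<And>i j. N i j \<in> hom_linear_functions n"
    and "r \<le> s"
    and det: "det (sqmat s (\<lambda>i j. (if i = j \<and> i < r then 1 else 0) - fps_X * fps_const (N i j))) =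
      fps_const f * fps_X ^ Suc (Suc k)"
  shows "habp n (Const c * f) \<le> enat (Suc k * ((s - r) * (s * (s - r))))"
proof -
  define e where "e = s - r"
  define Y where "Y = walk_product (mark_rows r N) s"
  \<comment> \<open>Head, current vertex, remaining power of \<open>z\<close>. Powers below
    \<open>e\<close> suffice, because the first step leaves a head, whose row is marked.\<close>
  define S where "S = (SIGMA h:{r..<s}. {..h} \<times> {..<e})"
  define y where "y = (\<lambda>(h, v, t) k. coeff (fps_nth (Y h v) k) t)"
  \<comment> \<open>On reaching \<open>h\<close> the current walk is closed; the next step leaves the next head \<open>h' > h\<close>, whose
    row is marked and carries the sign of \<open>1 - g\<close>.\<close>
  define T where "T = (\<lambda>(h, v, t) (h', w, u).
    if v = h then (if h < h' \<and> t = Suc u then - N h' w else 0)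
    else (if h' = h \<and> t = (if v < r then u else Suc u) then N v w else 0))"
  \<comment> \<open>The first step, out of the smallest selected head: it carries the sign, lowers
    the power from \<open>e\<close> to \<open>e - 1\<close> and absorbs the scalar
    \<open>c\<close>.\<close>
  define b where "b = (\<lambda>(h, v, t). if Suc t = e then Const c * - N h v else 0)"
  have sum_S: "(\<Sum>q\<in>S. F q) = (\<Sum>h\<in>{r..<s}. \<Sum>v\<le>h. \<Sum>t<e. F (h, v, t))"
    for F :: "nat \<times> nat \<times> nat \<Rightarrow> 'a mpoly"
    unfolding S_def using sum.Sigma[of "{r..<s}" "\<lambda>h. {..h} \<times> {..<e}" "\<lambda>h p. F (h, p)"]
    by (simp add: sum.cartesian_product split_def)
  have "finite S"
    by (simp add: S_def)
  have "card S = (\<Sum>h\<in>{r..<s}. Suc h * e)"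
    by (simp add: S_def)
  also have "\<dots> \<le> (\<Sum>h\<in>{r..<s}. s * e)"
    by (intro sum_mono mult_right_mono) auto
  finally have card: "card S \<le> e * (s * e)"
    by (simp add: e_def)
  have "Const c * f = (\<Sum>q\<in>S. b q * y q (Suc k))"
  proof -
    have "f = coeff (fps_nth (\<Prod>i\<in>{r..<s}. loop_factor (mark_rows r N) i) (Suc (Suc k))) e"
      using top_coeff_loop_product[OF \<open>r \<le> s\<close> det] by (simp add: e_def)
    also have "\<dots> = - (\<Sum>i\<in>{r..<s}. \<Sum>w\<le>i. coeff (mark_rows r N i w * fps_nth (Y i w) (Suc k)) e)"
      by (simp add: loop_product[OF \<open>r \<le> s\<close>] Y_def fps_sum_nth coeff_sum)
    also have "\<dots> = (\<Sum>i\<in>{r..<s}. \<Sum>w\<le>i. \<Sum>t<e. if Suc t = e then - N i w * y (i, w, t) (Suc k) else 0)"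
      unfolding sum_negf[symmetric] by (intro sum.cong refl)
        (auto simp: coeff_mark_rows_mult[where e = e] y_def simp flip: sum_negf intro!: sum.cong)
    finally show ?thesis
      unfolding sum_S by (simp add: sum_distrib_left b_def if_distrib[of "\<lambda>x. _ * x"]
          if_distrib[of "\<lambda>x. x * _"] mult.assoc cong: if_cong)
  qed
  moreover have "y q (Suc j) = (\<Sum>p\<in>S. T q p * y p j)" if "q \<in> S" for q j
  proof -
    obtain h v t where q: "q = (h, v, t)" "r \<le> h" "h < s" "v \<le> h" "t < e"
      using \<open>q \<in> S\<close> by (auto simp: S_def)
    show ?thesis
    proof (cases "v = h")
      case True
      have "y q (Suc j) = - (\<Sum>i\<in>{Suc h..<s}. \<Sum>w\<le>i. coeff (mark_rows r N i w * fps_nth (Y i w) j) t)"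
        using q True by (simp add: y_def Y_def walk_product_head coeff_sum)
      also have "\<dots> = (\<Sum>i\<in>{Suc h..<s}. \<Sum>w\<le>i. \<Sum>u<e. T q (i, w, u) * y (i, w, u) j)"
        unfolding sum_negf[symmetric] using q True
        by (intro sum.cong refl)
          (auto simp: coeff_mark_rows_mult[where e = e] y_def T_def
            simp flip: sum_negf intro!: sum.cong)
      also have "\<dots> = (\<Sum>p\<in>S. T q p * y p j)"
        unfolding sum_S using q True
        by (intro sum.mono_neutral_left) (auto simp: T_def)
      finally show ?thesis .
    next
      case False
      have "y q (Suc j) = (\<Sum>w\<le>h. coeff (mark_rows r N v w * fps_nth (Y h w) j) t)"
        using q False by (simp add: y_def Y_def walk_product_step coeff_sum)
      also have "\<dots> = (\<Sum>i\<in>{h}. \<Sum>w\<le>i. \<Sum>u<e. T q (i, w, u) * y (i, w, u) j)"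
        using q False by (auto simp: coeff_mark_rows_mult[where e = e] y_def T_def intro!: sum.cong)
      also have "\<dots> = (\<Sum>p\<in>S. T q p * y p j)"
        unfolding sum_S using q False
        by (intro sum.mono_neutral_left) (auto simp: T_def)
      finally show ?thesis .
    qed
  qed
  moreover have "y q 0 = Const ((\<lambda>(h, v, t). if v = h \<and> t = 0 then 1 else 0) q)" if "q \<in> S" for q
    using that by (auto simp: y_def Y_def S_def walk_product_0 coeff_1)
  moreover have "T p q \<in> hom_linear_functions n" for p q
    by (auto simp: T_def N hom_linear_functions_uminus hom_linear_functions_0 split: prod.splits)
  moreover have "b q \<in> hom_linear_functions n" for q
    by (simp only: b_def split: prod.splits)
      (auto simp only: N hom_linear_functions_uminus hom_linear_functions_scale hom_linear_functions_0
        split: if_splits)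
  ultimately have "habp n (Const c * f) \<le> enat (Suc k * card S)"
    using \<open>finite S\<close> by (intro habp_le_recurrence[of S T n b y]) blast+
  also have "\<dots> \<le> enat (Suc k * (e * (s * e)))"
    using mult_le_mono2[OF card, of "Suc k"] by simp
  finally show ?thesis
    by (simp add: e_def)
qed

text \<open>With all widths 0 the scalar product is an empty sum. Zero is treated separately because
  \<open>corank_le_order\<close> concerns nonzero forms.\<close>

lemma habp_0: "habp n 0 = 0"
proof -
  have "has_abp (hom_linear_functions n) 0 0 0"
    unfolding has_abp_def
    by (intro exI[of _ 0] exI[of _ "\<lambda>_. 0"] exI[of _ "vec 0 (\<lambda>_. 0)"]
        exI[of _ "\<lambda>_. 0\<^sub>m 0 0"])
      (auto simp: abp_product_def vec_set_def scalar_prod_def intro!: exI[of _ "vec 0 (\<lambda>_. 0)"])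
  then have "habp n 0 \<le> enat 0"
    unfolding habp_def by (intro Inf_lower) blast
  then show ?thesis
    by (simp flip: zero_enat_def)
qed

section \<open>Normalisation of a minimal representation and the final bound\<close>

lemma dc_attained:
  assumes "dc n f = enat s"
  obtains M where "det_repr n s M f"
proof -
  let ?A = "{enat s | s. \<exists>M. det_repr n s M f}"
  \<comment> \<open>The infimum of the empty set would be \<infinity>, not
    \<open>enat s\<close>.\<close>
  have "?A \<noteq> {}"
    using assms unfolding dc_def by (metis Inf_enat_def enat.distinct(1))
  then obtain x where "x \<in> ?A"
    by blast
  then have "(LEAST x. x \<in> ?A) \<in> ?A"
    by (rule LeastI)
  then have "Inf ?A \<in> ?A"
    using \<open>?A \<noteq> {}\<close> unfolding Inf_enat_def by (simp only: if_False)
  then show ?thesis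
    using assms that by (auto simp: dc_def)
qed

theorem theorem4p1:
  fixes f :: "'a::field mpoly" and n d s :: nat
  assumes "f \<in> polys_in n"
    and "homogeneous d f"
    and "d \<ge> 2"
    and "dc n f = enat s"
  shows "habp n f \<le> enat (absolute_constant * d ^ 5 * s)"
proof (cases "f = 0")
  case True
  then show ?thesis by (simp add: habp_0)
next
  case False
  obtain M where M: "M \<in> carrier_mat s s" "elements_mat M \<subseteq> linear_functions n" "det M = f"
    using dc_attained[OF assms(4)] by (auto simp: det_repr_def)
  have "\<exists>a L. L \<in> hom_linear_functions n \<and> M $$ (i, j) = Const a + L" if "i < s" "j < s" for i j
  proof -
    have "M $$ (i, j) \<in> linear_functions n"
      using M(1,2) that by (fastforce simp: elements_mat_def)
    then show ?thesis
      by (auto simp: linear_functions_def hom_linear_functions_def)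
  qed
  then obtain a L where aL: "\<And>i j. i < s \<Longrightarrow> j < s \<Longrightarrow>
      L i j \<in> hom_linear_functions n \<and> M $$ (i, j) = Const (a i j) + L i j"
    by metis
  obtain P Q r where PQ: "P \<in> carrier_mat s s" "Q \<in> carrier_mat s s" "det P \<noteq> 0" "det Q \<noteq> 0"
    "r \<le> s" "P * sqmat s a * Q = mat s s (\<lambda>(i, j). if i = j \<and> i < r then 1 else 0)"
    using rank_normal_form[OF sqmat_carrier] by blast
  define P' Q' where "P' = map_mat Const P" and "Q' = map_mat Const Q"
  have PQ': "P' \<in> carrier_mat s s" "Q' \<in> carrier_mat s s"
    using PQ by (auto simp: P'_def Q'_def)
  define c where "c = det P * det Q"
  \<comment> \<open>The sign matches the form \<open>J - N\<close>; the value 0 outside the matrix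
    makes every \<open>N i j\<close> homogeneous linear, as \<open>habp_le_corank\<close>
    demands.\<close>
  define N where "N i j = (if i < s \<and> j < s then - (P' * sqmat s L * Q') $$ (i, j) else 0)" for i j
  have N: "N i j \<in> hom_linear_functions n" for i j
  proof -
    have "(P' * sqmat s L * Q') $$ (i, j) =
        (\<Sum>l<s. Const (Q $$ (l, j)) * (\<Sum>k<s. Const (P $$ (i, k)) * L k l))" if "i < s" "j < s"
      using that PQ
      by (auto simp: P'_def Q'_def sqmat_def scalar_prod_def atLeast0LessThan mult.commute intro!: sum.cong)
    then show ?thesis
      using aL by (auto simp: N_def intro!: hom_linear_functions_uminus hom_linear_functions_0
          hom_linear_functions_sum hom_linear_functions_scale)
  qed
  have M_eq: "M = map_mat Const (sqmat s a) + sqmat s L"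
    using M(1) aL by (intro eq_matI) (auto simp: sqmat_def)
  have "P' * M * Q' = map_mat Const (P * sqmat s a * Q) + P' * sqmat s L * Q'"
  proof -
    have "map_mat Const (P * sqmat s a * Q) = P' * map_mat Const (sqmat s a) * Q'"
      using PQ(1,2) by (simp add: P'_def Q'_def Const.mat_hom_mult[of _ s s _ s])
    then show ?thesis
      unfolding M_eq using PQ'
      by (simp add: mult_add_distrib_mat[of _ s s _ s] add_mult_distrib_mat[of _ s s _ _ s])
  qed
  also have "\<dots> = sqmat s (\<lambda>i j. Const (if i = j \<and> i < r then 1 else 0) + - N i j)"
    unfolding PQ(6) using PQ' by (intro eq_matI) (auto simp: sqmat_def N_def)
  finally have "det (sqmat s (\<lambda>i j. Const (if i = j \<and> i < r then 1 else 0) + - N i j)) = det (P' * M * Q')"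
    by simp
  also have "\<dots> = Const c * f"
    using PQ' M PQ(1,2) by (simp add: det_mult[of _ s] c_def P'_def Q'_def Const.hom_mult mult_ac)
  finally have det: "det (sqmat s (\<lambda>i j. Const (if i = j \<and> i < r then 1 else 0) + - N i j)) = Const c * f" .
  have "homogeneous d (Const c * f)"
    using homogeneous_mult[OF homogeneous_Const assms(2)] by simp
  from det_homogenize[OF hom_linear_functions_uminus[OF N] det this]
  have "det (sqmat s (\<lambda>i j. (if i = j \<and> i < r then 1 else 0) - fps_X * fps_const (N i j))) =
      fps_const (Const c * f) * fps_X ^ d"
    by (simp add: if_distrib[of Const] if_distrib[of fps_const] cong: if_cong flip: fps_const_neg)
  note det' = this
  have "c \<noteq> 0"
    using PQ(3,4) by (simp add: c_def)
  \<comment> \<open>Normalisation multiplied \<open>f\<close> by \<open>c\<close>; the program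
    undoes this through the scalar in its first vector.\<close>
  then have scale: "Const (inverse c) * (Const c * f) = f"
    by (simp add: mult.assoc[symmetric] flip: Const.hom_mult)
  then have "Const c * f \<noteq> 0"
    using False by (metis mult_zero_right)
  from corank_le_order[OF det' this] have "s - r \<le> d" .
  \<comment> \<open>The two end vectors contribute one linear factor each, which leaves
    \<open>k = d - 2\<close> matrices.\<close>
  obtain k where k: "d = Suc (Suc k)"
    using assms(3) by (metis add_2_eq_Suc le_Suc_ex)
  have "habp n f \<le> enat (Suc k * ((s - r) * (s * (s - r))))"
    using habp_le_corank[OF N PQ(5) det'[unfolded k], of "inverse c"] by (simp add: scale)
  \<comment> \<open>The size is already at most \<open>d ^ 3 * s\<close>; the rest weakens this to
    the stated form.\<close>
  also have "Suc k * ((s - r) * (s * (s - r))) \<le> d * (d * (s * d))"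
    using \<open>s - r \<le> d\<close> k by (intro mult_le_mono) auto
  also have "\<dots> = d ^ 3 * s"
    by (simp add: power3_eq_cube)
  also have "\<dots> \<le> absolute_constant * d ^ 5 * s"
  proof (rule mult_right_mono)
    have "d ^ 3 \<le> d ^ 5"
      using assms(3) by (intro power_increasing) auto
    then show "d ^ 3 \<le> absolute_constant * d ^ 5"
      by (simp add: absolute_constant_def del: power_increasing_iff)
  qed simp
  finally show ?thesis
    by simp
qed

end
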